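(* Let $N\ge 3$ and $m\ge0$ be integers, $n=\tfrac{N(N-1)}2+m$, and let $f,h$ be complex $n\times n$ matrices satisfying $$i(f^\dagger h-h^\dagger f)=\mathbf 1,\qquad f^th-h^tf=0 .$$ Let $\mathcal N=hf^{-1}$. Write $f=(f^\Lambda_{AB},f^\Lambda_I)$ and $h=(h_{\Lambda AB},h_{\Lambda I})$ as in the context. For $g=(g^\Lambda),e=(e_\Lambda)\in\mathbb R^n$ define $$Z_{AB}=h_{\Lambda AB}\,g^\Lambda-f^\Lambda_{AB}\,e_\Lambda,\qquad Z_I=h_{\Lambda I}\,g^\Lambda-f^\Lambda_I\,e_\Lambda .$$ Then $$\tfrac12\sum_{A,B}Z_{AB}\bar Z^{AB}+\sum_IZ_I\bar Z^I=-\tfrac12\,P^t\,\mathcal M(\mathcal N)\,P,\qquad P=\begin{pmatrix}g\\ e\end{pmatrix},$$ where $$\mathcal M(\mathcal N)=\begin{pmatrix}\mathbf 1&-\mathrm{Re}\,\mathcal N\\0&\mathbf 1\end{pmatrix}\begin{pmatrix}\mathrm{Im}\,\mathcal N&0\\0&(\mathrm{Im}\,\mathcal N)^{-1}\end{pmatrix}\begin{pmatrix}\mathbf 1&0\\-\mathrm{Re}\,\mathcal N&\mathbf 1\end{pmatrix}.$$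
   Context: The rows of $f$ and $h$ are labelled by $\Lambda=1,\dots,n$. The columns are labelled by the antisymmetric pairs $AB$, $A,B=1,\dots,N$ (independent columns $A<B$, extended antisymmetrically to all $A,B$), and by $I=1,\dots,m$. The factor $\tfrac12$ compensates for summing over all ordered pairs $(A,B)$. $\bar Z^{AB}=(Z_{AB})^*$ and $\bar Z^I=(Z_I)^*$ are complex conjugates; $\mathrm{Re}\,\mathcal N$ and $\mathrm{Im}\,\mathcal N$ are the entrywise real and imaginary parts of $\mathcal N$. Repeated indices $\Lambda$ are summed from $1$ to $n$. The stated algebraic relations imply that $f$ and $\mathrm{Im}\,\mathcal N$ are invertible and that $\mathcal N$ is symmetric. *)

theory Defs
  imports Complex_Main "Jordan_Normal_Form.Gauss_Jordan_Elimination"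
    "Jordan_Normal_Form.Schur_Decomposition"
begin

text \<open>All labels are 0-based: \<open>A, B < N\<close>, \<open>I < m\<close>, and \<open>\<Lambda> < n\<close>.\<close>

definition ordered_pairs :: "nat \<Rightarrow> (nat \<times> nat) set" where
  "ordered_pairs N = {(A, B). A < B \<and> B < N}"

text \<open>
  An \<open>n \<times> n\<close> matrix with \<open>n = N (N - 1) / 2 + m\<close> has first the columns labelled by the
  pairs \<open>A < B\<close> and then those labelled by \<open>I < m\<close>.  The order of the pair columns is not
  canonical: \<open>pos (A, B)\<close> is the position of the column of the pair \<open>A < B\<close>, and \<open>pos\<close> is
  any bijection of the pairs onto the first \<open>N (N - 1) / 2\<close> positions.
\<close>

definition pair_numbering :: "nat \<Rightarrow> (nat \<times> nat \<Rightarrow> nat) \<Rightarrow> bool" where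
  "pair_numbering N pos \<longleftrightarrow> bij_betw pos (ordered_pairs N) {..<N * (N - 1) div 2}"

definition pair_entry :: "(nat \<times> nat \<Rightarrow> nat) \<Rightarrow> complex mat \<Rightarrow> nat \<Rightarrow> nat \<Rightarrow> nat \<Rightarrow> complex" where
  "pair_entry pos F \<Lambda> A B =
    (if A < B then F $$ (\<Lambda>, pos (A, B))
     else if B < A then - F $$ (\<Lambda>, pos (B, A))
     else 0)"

definition single_entry :: "nat \<Rightarrow> complex mat \<Rightarrow> nat \<Rightarrow> nat \<Rightarrow> complex" where
  "single_entry N F \<Lambda> I = F $$ (\<Lambda>, N * (N - 1) div 2 + I)"

definition Z_pair ::
  "nat \<Rightarrow> (nat \<times> nat \<Rightarrow> nat) \<Rightarrow> complex mat \<Rightarrow> complex mat \<Rightarrow> real vec \<Rightarrow> real vec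
    \<Rightarrow> nat \<Rightarrow> nat \<Rightarrow> complex" where
  "Z_pair n pos f h g e A B =
    (\<Sum>\<Lambda><n. pair_entry pos h \<Lambda> A B * complex_of_real (g $ \<Lambda>))
    - (\<Sum>\<Lambda><n. pair_entry pos f \<Lambda> A B * complex_of_real (e $ \<Lambda>))"

definition Z_single ::
  "nat \<Rightarrow> nat \<Rightarrow> complex mat \<Rightarrow> complex mat \<Rightarrow> real vec \<Rightarrow> real vec \<Rightarrow> nat \<Rightarrow> complex" where
  "Z_single n N f h g e I =
    (\<Sum>\<Lambda><n. single_entry N h \<Lambda> I * complex_of_real (g $ \<Lambda>))
    - (\<Sum>\<Lambda><n. single_entry N f \<Lambda> I * complex_of_real (e $ \<Lambda>))"

text \<open>Unspecified if \<open>A\<close> is not invertible.\<close>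

definition matinv :: "'a :: field mat \<Rightarrow> 'a mat" where
  "matinv A = the (mat_inverse A)"

definition kinetic_matrix :: "complex mat \<Rightarrow> complex mat \<Rightarrow> complex mat" where
  "kinetic_matrix f h = h * matinv f"

definition M_matrix :: "nat \<Rightarrow> complex mat \<Rightarrow> real mat" where
  "M_matrix n \<N> =
    (let R = map_mat Re \<N>; J = map_mat Im \<N> in
      four_block_mat (1\<^sub>m n) (- R) (0\<^sub>m n n) (1\<^sub>m n)
      * four_block_mat J (0\<^sub>m n n) (0\<^sub>m n n) (matinv J)
      * four_block_mat (1\<^sub>m n) (0\<^sub>m n n) (- R) (1\<^sub>m n))"

end

theory Submission
  imports Defs
begin

text \<open>
  With \<open>w = \<N> g - e\<close> the charges are \<open>Z = f\<^sup>t w\<close>, as \<open>h = \<N> f\<close> and \<open>\<N>\<close> is symmetric; hence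
  their square norm is the value at \<open>w\<close> of the Hermitian form of \<open>f f\<^sup>\<dagger>\<close>.  The first relation
  between \<open>f\<close> and \<open>h\<close> reads \<open>- 2 f\<^sup>\<dagger> (Im \<N>) f = 1\<close>, that is \<open>f f\<^sup>\<dagger> = - (Im \<N>)\<^sup>-\<^sup>1 / 2\<close>, a real
  symmetric matrix.  Splitting \<open>w = (Re \<N> g - e) + \<i> Im \<N> g\<close> into real and imaginary part
  gives the two blocks of \<open>\<M>(\<N>)\<close>.
\<close>

section \<open>Adjoints, inverses and scalar multiples of matrices\<close>

lemma comm_ring_hom_cnj: "comm_ring_hom cnj"
  by unfold_locales auto

lemma mat_adjoint_eq_transpose_cnj: "mat_adjoint A = transpose_mat (map_mat cnj A)"
  by (rule eq_matI) (auto simp: mat_adjoint_def mat_of_rows_def)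

lemma matinv_mult:
  fixes A :: "'a :: field mat"
  assumes A: "A \<in> carrier_mat n n" and det: "det A \<noteq> 0"
  shows "matinv A \<in> carrier_mat n n" "A * matinv A = 1\<^sub>m n" "matinv A * A = 1\<^sub>m n"
proof -
  obtain B where "mat_inverse A = Some B"
    \<comment> \<open>\<open>b\<close> is the extension slot of the record for the ring of matrices;
      any value serves, but both facts must speak of the same ring.\<close>
    using mat_inverse(1)[OF A, where b = "()"] det_non_zero_imp_unit[OF A det, where b = "()"]
    by (cases "mat_inverse A") auto
  then show "matinv A \<in> carrier_mat n n" "A * matinv A = 1\<^sub>m n" "matinv A * A = 1\<^sub>m n"
    using mat_inverse(2)[OF A] by (auto simp: matinv_def)
qed

lemma det_nonzero_if_right_inverse:
  fixes A :: "'a :: comm_ring_1 mat"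
  assumes "A \<in> carrier_mat n n" "B \<in> carrier_mat n n" "A * B = 1\<^sub>m n"
  shows "det A \<noteq> 0"
  using det_mult[OF assms(1,2)] assms(3) by auto

lemma smult_mat_mult_vec:
  fixes A :: "'a :: comm_ring_1 mat"
  assumes "A \<in> carrier_mat nr nc" "v \<in> carrier_vec nc"
  shows "(k \<cdot>\<^sub>m A) *\<^sub>v v = k \<cdot>\<^sub>v (A *\<^sub>v v)"
  by (rule eq_vecI) (use assms in auto)

lemma smult_smult_mat:
  fixes A :: "'a :: semigroup_mult mat"
  shows "a \<cdot>\<^sub>m (b \<cdot>\<^sub>m A) = (a * b) \<cdot>\<^sub>m A"
  by (rule eq_matI) (auto simp: mult.assoc)

lemma zero_mat_mult_vec:
  fixes v :: "'a :: semiring_0 vec"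
  assumes "v \<in> carrier_vec nc"
  shows "0\<^sub>m nr nc *\<^sub>v v = 0\<^sub>v nr"
  by (rule eq_vecI) (use assms in auto)

section \<open>The quadratic form of the block matrix\<close>

text \<open>The right factor of \<open>M_matrix\<close> sends the pair \<open>g\<close>,
  \<open>e\<close> to \<open>g\<close>, \<open>e - R g\<close>. As \<open>R\<close> is symmetric,
  the left factor is its transpose, so only the block diagonal form at that vector remains.\<close>

lemma scalar_prod_M_matrix:
  fixes g e :: "real vec" and \<N> :: "complex mat"
  defines "R \<equiv> map_mat Re \<N>" and "J \<equiv> map_mat Im \<N>"
  assumes \<N>: "\<N> \<in> carrier_mat n n" and sym: "transpose_mat \<N> = \<N>"
    and K: "matinv J \<in> carrier_mat n n"
    and g: "g \<in> carrier_vec n" and e: "e \<in> carrier_vec n"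
  shows "(g @\<^sub>v e) \<bullet> (M_matrix n \<N> *\<^sub>v (g @\<^sub>v e))
    = g \<bullet> (J *\<^sub>v g) + (R *\<^sub>v g - e) \<bullet> (matinv J *\<^sub>v (R *\<^sub>v g - e))"
proof -
  have R: "R \<in> carrier_mat n n" and J: "J \<in> carrier_mat n n"
    using \<N> by (auto simp: R_def J_def)
  have Rt: "transpose_mat R = R"
    unfolding R_def map_mat_transpose sym ..
  let ?L = "four_block_mat (1\<^sub>m n) (- R) (0\<^sub>m n n) (1\<^sub>m n)"
  let ?D = "four_block_mat J (0\<^sub>m n n) (0\<^sub>m n n) (matinv J)"
  let ?U = "four_block_mat (1\<^sub>m n) (0\<^sub>m n n) (- R) (1\<^sub>m n)"
  let ?y = "R *\<^sub>v g - e"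
  \<comment> \<open>The lower block yields \<open>e - R g\<close>. Writing it as \<open>- ?y\<close>
    lets the two signs cancel at the end of the computation.\<close>
  let ?x = "- ?y"
  let ?k = "matinv J *\<^sub>v ?x"
  have y: "?y \<in> carrier_vec n" and x: "?x \<in> carrier_vec n" and k: "?k \<in> carrier_vec n"
    using R g e K by auto
  have L: "?L \<in> carrier_mat (n + n) (n + n)" and D: "?D \<in> carrier_mat (n + n) (n + n)"
    and U: "?U \<in> carrier_mat (n + n) (n + n)"
    using R J K by auto
  have ge: "g @\<^sub>v e \<in> carrier_vec (n + n)" using g e by auto
  have "?U *\<^sub>v (g @\<^sub>v e) = g @\<^sub>v ?x"
    using four_block_mat_mult_vec[of "1\<^sub>m n" n n "0\<^sub>m n n" n "- R" n "1\<^sub>m n" g e] R g e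
    by auto
  moreover have "?D *\<^sub>v (g @\<^sub>v ?x) = (J *\<^sub>v g) @\<^sub>v ?k"
    using mult_mat_vec_split[OF J K g x] .
  moreover have "?L *\<^sub>v ((J *\<^sub>v g) @\<^sub>v ?k) = (J *\<^sub>v g - R *\<^sub>v ?k) @\<^sub>v ?k"
    using four_block_mat_mult_vec[of "1\<^sub>m n" n n "- R" n "0\<^sub>m n n" n "1\<^sub>m n" "J *\<^sub>v g" ?k] R J K g k
    by (simp add: zero_mat_mult_vec minus_add_uminus_vec[of _ n])
  ultimately have "M_matrix n \<N> *\<^sub>v (g @\<^sub>v e) = (J *\<^sub>v g - R *\<^sub>v ?k) @\<^sub>v ?k"
    using assoc_mult_mat_vec[OF mult_carrier_mat[OF L D] U ge]
      assoc_mult_mat_vec[OF L D mult_mat_vec_carrier[OF U ge]]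
    by (simp add: M_matrix_def Let_def R_def[symmetric] J_def[symmetric])
  then have "(g @\<^sub>v e) \<bullet> (M_matrix n \<N> *\<^sub>v (g @\<^sub>v e)) = g \<bullet> (J *\<^sub>v g - R *\<^sub>v ?k) + e \<bullet> ?k"
    using scalar_prod_append[OF g e, of "J *\<^sub>v g - R *\<^sub>v ?k" ?k] R J g k by simp
  also have "\<dots> = g \<bullet> (J *\<^sub>v g) - g \<bullet> (R *\<^sub>v ?k) + e \<bullet> ?k"
    using R J g k by (subst scalar_prod_minus_distrib[of _ n]) auto
  \<comment> \<open>Symmetry of \<open>R\<close> moves it onto \<open>g\<close>, so that this term
    and \<open>e \<bullet> ?k\<close> combine into a product with \<open>?y\<close>.\<close>
  also have "g \<bullet> (R *\<^sub>v ?k) = (R *\<^sub>v g) \<bullet> ?k"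
    using transpose_vec_mult_scalar[OF R k g] Rt by simp
  also have "g \<bullet> (J *\<^sub>v g) - (R *\<^sub>v g) \<bullet> ?k + e \<bullet> ?k = g \<bullet> (J *\<^sub>v g) - ?y \<bullet> ?k"
    using R g e k by (subst minus_scalar_prod_distrib[of _ n]) auto
  also have "?k = - (matinv J *\<^sub>v ?y)"
    by (rule eq_vecI) (use R g e K in auto)
  also have "g \<bullet> (J *\<^sub>v g) - ?y \<bullet> (- (matinv J *\<^sub>v ?y)) = g \<bullet> (J *\<^sub>v g) + ?y \<bullet> (matinv J *\<^sub>v ?y)"
    using e K by (subst scalar_prod_uminus_right) auto
  finally show ?thesis .
qed

section \<open>Consequences of the algebraic relations\<close>

text \<open>The first relation makes \<open>f\<close> injective, and the second then makes
  \<open>\<N>\<close> symmetric. Inserting \<open>h = \<N> f\<close> back into the first exhibits a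
  multiple of \<open>f * mat_adjoint f\<close> as the inverse of \<open>J\<close>.\<close>

lemma kinetic_matrix_properties:
  fixes f h :: "complex mat"
  defines "\<N> \<equiv> kinetic_matrix f h"
  defines "J \<equiv> map_mat Im \<N>"
  assumes f: "f \<in> carrier_mat n n" and h: "h \<in> carrier_mat n n"
    and 1: "\<i> \<cdot>\<^sub>m (mat_adjoint f * h - mat_adjoint h * f) = 1\<^sub>m n"
    and 2: "transpose_mat f * h - transpose_mat h * f = 0\<^sub>m n n"
  shows "\<N> \<in> carrier_mat n n" "transpose_mat \<N> = \<N>" "\<N> * f = h"
    "det J \<noteq> 0" "map_mat complex_of_real (matinv J) = (- 2) \<cdot>\<^sub>m (f * mat_adjoint f)"
proof -
  interpret cnj: comm_ring_hom cnj by (rule comm_ring_hom_cnj)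
  have adj: "mat_adjoint A \<in> carrier_mat n n" if "A \<in> carrier_mat n n" for A :: "complex mat"
    using that by (simp add: mat_adjoint_eq_transpose_cnj)
  note [simp] = adj[OF f] adj[OF h] f h mult_carrier_mat[of _ n n _ n]
    left_mult_one_mat[of _ n n] right_mult_one_mat[of _ n n]
    carrier_matD[OF f] carrier_matD[OF h]
  \<comment> \<open>Apply the first relation to a vector \<open>v\<close> in the kernel of
    \<open>f\<close>: the term ending in \<open>f\<close> vanishes. In the product with
    \<open>conjugate v\<close>, the adjoint of \<open>f\<close> in the other term moves across and
    annihilates \<open>conjugate v\<close>. Hence \<open>v\<close> has norm zero.\<close>
  have "det f \<noteq> 0"
  proof
    assume "det f = 0"
    then obtain v where v: "v \<in> carrier_vec n" "v \<noteq> 0\<^sub>v n" "f *\<^sub>v v = 0\<^sub>v n"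
      using det_0_iff_vec_prod_zero_field[OF f] by auto
    have cf: "map_mat cnj f *\<^sub>v conjugate v = 0\<^sub>v n"
    proof -
      have "map_mat cnj f *\<^sub>v map_vec cnj v = map_vec cnj (f *\<^sub>v v)"
        by (rule cnj.mult_mat_vec_hom[OF f v(1), symmetric])
      moreover have "map_vec cnj v = conjugate v" by auto
      ultimately show ?thesis by (simp add: v cnj.vec_hom_zero)
    qed
    have u: "mat_adjoint f *\<^sub>v (h *\<^sub>v v) \<in> carrier_vec n"
      using adj[OF f] h v by (metis mult_mat_vec_carrier)
    have "v = (\<i> \<cdot>\<^sub>m (mat_adjoint f * h - mat_adjoint h * f)) *\<^sub>v v"
      using v 1 by simp
    also have "\<dots> = \<i> \<cdot>\<^sub>v (mat_adjoint f *\<^sub>v (h *\<^sub>v v) - mat_adjoint h *\<^sub>v (f *\<^sub>v v))"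
    proof -
      have fh: "mat_adjoint f * h \<in> carrier_mat n n" and hf: "mat_adjoint h * f \<in> carrier_mat n n"
        by simp_all
      show ?thesis
        unfolding smult_mat_mult_vec[OF minus_carrier_mat[OF hf] v(1)]
          minus_mult_distrib_mat_vec[OF fh hf v(1)]
          assoc_mult_mat_vec[OF adj[OF f] h v(1)] assoc_mult_mat_vec[OF adj[OF h] f v(1)] ..
    qed
    also have "\<dots> = \<i> \<cdot>\<^sub>v (mat_adjoint f *\<^sub>v (h *\<^sub>v v))"
    proof -
      have "mat_adjoint h *\<^sub>v 0\<^sub>v n = 0\<^sub>v n"
        by (rule eq_vecI) (auto simp: mat_adjoint_eq_transpose_cnj)
      then show ?thesis using u v(3) by simp
    qed
    finally have eq: "v = \<i> \<cdot>\<^sub>v (mat_adjoint f *\<^sub>v (h *\<^sub>v v))" .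
    have "v \<bullet> conjugate v = \<i> * ((mat_adjoint f *\<^sub>v (h *\<^sub>v v)) \<bullet> conjugate v)"
      by (subst eq) (rule smult_scalar_prod_distrib[OF u carrier_vec_conjugate[OF v(1)]])
    also have "(mat_adjoint f *\<^sub>v (h *\<^sub>v v)) \<bullet> conjugate v = (h *\<^sub>v v) \<bullet> (map_mat cnj f *\<^sub>v conjugate v)"
      unfolding mat_adjoint_eq_transpose_cnj
      by (rule transpose_vec_mult_scalar[OF _ carrier_vec_conjugate[OF v(1)] mult_mat_vec_carrier[OF h v(1)]]) simp
    also have "\<dots> = 0"
      unfolding cf by (rule scalar_prod_right_zero[OF mult_mat_vec_carrier[OF h v(1)]])
    finally show False using v conjugate_square_eq_0_vec[OF v(1)] by auto
  qed
  note F = matinv_mult[OF f this]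
  define F where "F = matinv f"
  have F: "F \<in> carrier_mat n n" "f * F = 1\<^sub>m n" "F * f = 1\<^sub>m n"
    using F by (auto simp: F_def)
  have N_def: "\<N> = h * F" by (simp add: \<N>_def kinetic_matrix_def F_def)
  show N: "\<N> \<in> carrier_mat n n" using F(1) by (simp add: N_def)
  note [simp] = N F(1)
  show Nf: "\<N> * f = h"
    unfolding N_def by (subst assoc_mult_mat[of _ n n _ n _ n]) (auto simp: F)
  have fh_sym: "transpose_mat f * h = transpose_mat h * f"
  proof -
    have "transpose_mat f * h = (transpose_mat f * h - transpose_mat h * f) + transpose_mat h * f"
      by (rule eq_matI) auto
    then show ?thesis unfolding 2 by (simp add: left_add_zero_mat[of _ n n])
  qed
  have FtT: "transpose_mat F * transpose_mat f = 1\<^sub>m n"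
    using transpose_mult[OF f F(1)] F(2) by simp
  \<comment> \<open>Inserting \<open>f * F = 1\<close> after \<open>transpose_mat h\<close> produces
    the product to which the second relation applies.\<close>
  have "transpose_mat \<N> = transpose_mat F * (transpose_mat h * f) * F"
    unfolding N_def by (simp add: transpose_mult[of _ n n _ n] assoc_mult_mat[of _ n n _ n _ n] F)
  also have "\<dots> = transpose_mat F * transpose_mat f * (h * F)"
    unfolding fh_sym[symmetric] by (simp add: assoc_mult_mat[of _ n n _ n _ n])
  also have "\<dots> = \<N>"
    by (simp add: FtT N_def[symmetric] left_mult_one_mat[of _ n n])
  finally show Nt: "transpose_mat \<N> = \<N>" .
  let ?J = "map_mat complex_of_real J"
  let ?C = "map_mat cnj \<N>"
  have J: "J \<in> carrier_mat n n" by (simp add: J_def)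
  note [simp] = J
  \<comment> \<open>The adjoint of \<open>\<N>\<close> is its entrywise conjugate, because
    \<open>\<N>\<close> is symmetric.\<close>
  have "mat_adjoint h = mat_adjoint f * ?C"
  proof -
    have "map_mat cnj h = ?C * map_mat cnj f"
      unfolding Nf[symmetric] by (rule cnj.mat_hom_mult[OF N f])
    then show ?thesis unfolding mat_adjoint_eq_transpose_cnj
      by (simp add: transpose_mult[of _ n n _ n] map_mat_transpose Nt)
  qed
  then have "mat_adjoint f * h - mat_adjoint h * f = mat_adjoint f * ((\<N> - ?C) * f)"
    unfolding Nf[symmetric]
    by (simp add: assoc_mult_mat[of _ n n _ n _ n] mult_minus_distrib_mat[of _ n n _ n]
        minus_mult_distrib_mat[of _ n n _ _ n])
  also have "\<N> - ?C = (2 * \<i>) \<cdot>\<^sub>m ?J"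
    by (rule eq_matI) (use carrier_matD[OF N] in \<open>auto simp: J_def complex_diff_cnj\<close>)
  finally have "1\<^sub>m n = \<i> \<cdot>\<^sub>m (mat_adjoint f * ((2 * \<i>) \<cdot>\<^sub>m ?J * f))"
    using 1 by simp
  also have "\<dots> = ((- 2) \<cdot>\<^sub>m (mat_adjoint f * ?J)) * f"
    by (simp add: mult_smult_distrib[of _ n n _ n] mult_smult_assoc_mat[of _ n n _ n]
        assoc_mult_mat[of _ n n _ n _ n] smult_smult_mat mult.left_commute[of \<i> 2])
  finally have left: "((- 2) \<cdot>\<^sub>m (mat_adjoint f * ?J)) * f = 1\<^sub>m n" ..
  \<comment> \<open>A left inverse of a square matrix is also a right inverse. This carries
    \<open>f\<close> from the right end to the left, where regrouping isolates
    \<open>?J\<close>.\<close>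
  have "f * ((- 2) \<cdot>\<^sub>m (mat_adjoint f * ?J)) = 1\<^sub>m n"
    by (rule mat_mult_left_right_inverse[OF _ f left]) simp
  then have inv: "((- 2) \<cdot>\<^sub>m (f * mat_adjoint f)) * ?J = 1\<^sub>m n"
    by (simp add: mult_smult_distrib[of _ n n _ n] mult_smult_assoc_mat[of _ n n _ n]
        assoc_mult_mat[of _ n n _ n _ n])
  have right: "?J * ((- 2) \<cdot>\<^sub>m (f * mat_adjoint f)) = 1\<^sub>m n"
    by (rule mat_mult_left_right_inverse[OF _ _ inv]) simp_all
  have "det ?J \<noteq> 0"
    by (rule det_nonzero_if_right_inverse[OF _ _ right]) simp_all
  then show detJ: "det J \<noteq> 0" by simp
  note K = matinv_mult[OF J detJ]
  let ?K = "map_mat complex_of_real (matinv J)"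
  have JK: "?J * ?K = 1\<^sub>m n"
    unfolding of_real_hom.mat_hom_mult[OF J K(1), symmetric] K(2) of_real_hom.mat_hom_one ..
  \<comment> \<open>Uniqueness of inverses: a left inverse and a right inverse of \<open>?J\<close>
    coincide.\<close>
  have "?K = (((- 2) \<cdot>\<^sub>m (f * mat_adjoint f)) * ?J) * ?K"
    unfolding inv using K(1) by (simp add: left_mult_one_mat[of _ n n])
  also have "\<dots> = (- 2) \<cdot>\<^sub>m (f * mat_adjoint f) * (?J * ?K)"
    using K(1) by (intro assoc_mult_mat[of _ n n _ n _ n]) auto
  also have "\<dots> = (- 2) \<cdot>\<^sub>m (f * mat_adjoint f)"
    unfolding JK by (intro right_mult_one_mat[of _ n n]) auto
  finally show "?K = (- 2) \<cdot>\<^sub>m (f * mat_adjoint f)" .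
qed

section \<open>Hermitian forms with real coefficients\<close>

text \<open>The cross terms carry the factors \<open>\<i>\<close> and \<open>- \<i>\<close> and
  cancel by symmetry of \<open>K\<close>. The product \<open>\<bullet>\<close> is bilinear, so the
  conjugation is explicit.\<close>

lemma hermitian_form_of_real_symmetric:
  fixes K :: "real mat" and a b :: "real vec"
  defines "w \<equiv> map_vec complex_of_real a + \<i> \<cdot>\<^sub>v map_vec complex_of_real b"
  assumes K: "K \<in> carrier_mat n n" and sym: "transpose_mat K = K"
    and a: "a \<in> carrier_vec n" and b: "b \<in> carrier_vec n"
  shows "w \<bullet> (map_mat complex_of_real K *\<^sub>v conjugate w)
    = complex_of_real (a \<bullet> (K *\<^sub>v a) + b \<bullet> (K *\<^sub>v b))"
proof -
  let ?K = "map_mat complex_of_real K" and ?a = "map_vec complex_of_real a"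
    and ?b = "map_vec complex_of_real b"
  have real: "map_vec complex_of_real u \<bullet> (?K *\<^sub>v map_vec complex_of_real v)
      = complex_of_real (u \<bullet> (K *\<^sub>v v))"
    if "u \<in> carrier_vec n" "v \<in> carrier_vec n" for u v
    using that K by (simp add: scalar_prod_def)
  have comm: "b \<bullet> (K *\<^sub>v a) = a \<bullet> (K *\<^sub>v b)"
    using transpose_vec_mult_scalar[OF K a b] comm_scalar_prod[of "K *\<^sub>v b" n a] sym K a b by simp
  have cw: "conjugate w = ?a + (- \<i>) \<cdot>\<^sub>v ?b"
    using a b by (auto simp: w_def)
  have "?K *\<^sub>v conjugate w = ?K *\<^sub>v ?a + (- \<i>) \<cdot>\<^sub>v (?K *\<^sub>v ?b)"
    unfolding cw using K a b
    by (simp add: mult_add_distrib_mat_vec[of _ n n] mult_mat_vec[of _ n n])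
  then have "w \<bullet> (?K *\<^sub>v conjugate w)
      = ?a \<bullet> (?K *\<^sub>v ?a) + (- \<i>) * (?a \<bullet> (?K *\<^sub>v ?b))
        + \<i> * (?b \<bullet> (?K *\<^sub>v ?a) + (- \<i>) * (?b \<bullet> (?K *\<^sub>v ?b)))"
    unfolding w_def using K a b
    by (simp add: add_scalar_prod_distrib[of _ n] scalar_prod_add_distrib[of _ n] algebra_simps)
  then show ?thesis
    using a b by (simp add: real comm algebra_simps)
qed

section \<open>The sum over charges as a squared norm\<close>

text \<open>Raising \<open>N\<close> by one adds a row and a column with equal sums and a zero
  corner, while the ordered pairs gain only the column.\<close>

lemma sum_symmetric_ordered_pairs:
  fixes q :: "nat \<Rightarrow> nat \<Rightarrow> 'a :: comm_semiring_1"
  assumes "\<And>A B. q A B = q B A" "\<And>A. q A A = 0"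
  shows "(\<Sum>A<N. \<Sum>B<N. q A B) = 2 * (\<Sum>(A, B) \<in> ordered_pairs N. q A B)"
proof (induction N)
  case 0
  then show ?case by (simp add: ordered_pairs_def)
next
  case (Suc N)
  have split: "ordered_pairs (Suc N) = ordered_pairs N \<union> (\<lambda>A. (A, N)) ` {..<N}"
    by (auto simp: ordered_pairs_def less_Suc_eq)
  have "finite (ordered_pairs N)"
    by (rule finite_subset[of _ "{..<N} \<times> {..<N}"]) (auto simp: ordered_pairs_def)
  then have "(\<Sum>(A, B) \<in> ordered_pairs (Suc N). q A B)
      = (\<Sum>(A, B) \<in> ordered_pairs N. q A B) + (\<Sum>A<N. q A N)"
    unfolding split
    by (subst sum.union_disjoint) (auto simp: ordered_pairs_def sum.reindex inj_on_def)
  moreover have "(\<Sum>A<Suc N. \<Sum>B<Suc N. q A B)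
      = (\<Sum>A<N. \<Sum>B<N. q A B) + (\<Sum>A<N. q A N) + (\<Sum>A<N. q N A)"
    by (simp add: sum.distrib assms(2) ac_simps)
  moreover have "(\<Sum>A<N. q N A) = (\<Sum>A<N. q A N)"
    by (simp add: assms(1)[of N])
  ultimately show ?case
    by (simp add: Suc.IH algebra_simps mult_2)
qed

text \<open>The factor one half leaves one term for each pair column. These columns fill the first
  \<open>N * (N - 1) div 2\<close> positions and the single ones the next \<open>m\<close>, so
  together they give all entries of \<open>z\<close>, in whatever order \<open>pos\<close>
  chooses.\<close>

lemma sum_Z_eq_hermitian_square:
  fixes f h :: "complex mat" and g e :: "real vec"
  defines "z \<equiv> transpose_mat h *\<^sub>v map_vec complex_of_real g
    - transpose_mat f *\<^sub>v map_vec complex_of_real e"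
  assumes n: "n = N * (N - 1) div 2 + m" and pos: "pair_numbering N pos"
    and f: "f \<in> carrier_mat n n" and h: "h \<in> carrier_mat n n"
    and g: "g \<in> carrier_vec n" and e: "e \<in> carrier_vec n"
  shows "1 / 2 * (\<Sum>A<N. \<Sum>B<N. Z_pair n pos f h g e A B * cnj (Z_pair n pos f h g e A B))
      + (\<Sum>I<m. Z_single n N f h g e I * cnj (Z_single n N f h g e I)) = z \<bullet> conjugate z"
proof -
  define k where "k = N * (N - 1) div 2"
  let ?q = "\<lambda>A B. Z_pair n pos f h g e A B * cnj (Z_pair n pos f h g e A B)"
  let ?s = "\<lambda>p. z $ p * cnj (z $ p)"
  have z: "z $ p = (\<Sum>\<Lambda><n. h $$ (\<Lambda>, p) * complex_of_real (g $ \<Lambda>))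
      - (\<Sum>\<Lambda><n. f $$ (\<Lambda>, p) * complex_of_real (e $ \<Lambda>))" if "p < n" for p
    using that f h g e by (simp add: z_def scalar_prod_def lessThan_atLeast0)
  \<comment> \<open>The sign cancels in the product with the conjugate, which makes
    \<open>?q\<close> symmetric.\<close>
  have "Z_pair n pos f h g e B A = - Z_pair n pos f h g e A B" for A B
    by (cases A B rule: linorder_cases) (simp_all add: Z_pair_def pair_entry_def sum_negf)
  then have "?q A B = ?q B A" for A B by (metis complex_cnj_minus minus_mult_minus)
  moreover have "?q A A = 0" for A by (simp add: Z_pair_def pair_entry_def)
  ultimately have "(\<Sum>A<N. \<Sum>B<N. ?q A B) = 2 * (\<Sum>(A, B) \<in> ordered_pairs N. ?q A B)"
    by (rule sum_symmetric_ordered_pairs)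
  also have "(\<Sum>(A, B) \<in> ordered_pairs N. ?q A B) = (\<Sum>x \<in> ordered_pairs N. ?s (pos x))"
  proof (rule sum.cong[OF refl])
    fix x assume x: "x \<in> ordered_pairs N"
    obtain A B where AB: "x = (A, B)" by (cases x)
    have "pos x < n"
      using pos x bij_betwE n unfolding pair_numbering_def by fastforce
    then show "(case x of (A, B) \<Rightarrow> ?q A B) = ?s (pos x)"
      using x z by (simp add: AB Z_pair_def pair_entry_def ordered_pairs_def)
  qed
  also have "\<dots> = (\<Sum>p<k. ?s p)"
    using pos unfolding pair_numbering_def k_def by (rule sum.reindex_bij_betw)
  finally have pairs: "(\<Sum>A<N. \<Sum>B<N. ?q A B) = 2 * (\<Sum>p<k. ?s p)" .
  have "(\<Sum>I<m. Z_single n N f h g e I * cnj (Z_single n N f h g e I)) = (\<Sum>I<m. ?s (k + I))"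
    by (rule sum.cong) (simp_all add: Z_single_def single_entry_def z n k_def)
  moreover have "z \<bullet> conjugate z = (\<Sum>p<k + m. ?s p)"
    using f h g e by (simp add: z_def scalar_prod_def lessThan_atLeast0 n k_def)
  moreover have "(\<Sum>p<k + m. ?s p) = (\<Sum>p<k. ?s p) + (\<Sum>I<m. ?s (k + I))"
    by (induction m) auto
  ultimately show ?thesis
    by (simp only: pairs) simp
qed

section \<open>The sum rule for the charges\<close>

theorem mainTheorem2:
  fixes N m n :: nat
    and pos :: "nat \<times> nat \<Rightarrow> nat"
    and f h :: "complex mat"
    and g e :: "real vec"
  assumes "N \<ge> 3"
    and "n = N * (N - 1) div 2 + m"
    and "pair_numbering N pos"
    and "f \<in> carrier_mat n n" and "h \<in> carrier_mat n n"
    and "\<i> \<cdot>\<^sub>m (mat_adjoint f * h - mat_adjoint h * f) = 1\<^sub>m n"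
    and "transpose_mat f * h - transpose_mat h * f = 0\<^sub>m n n"
    and "g \<in> carrier_vec n" and "e \<in> carrier_vec n"
  shows "1 / 2 * (\<Sum>A<N. \<Sum>B<N. Z_pair n pos f h g e A B * cnj (Z_pair n pos f h g e A B))
      + (\<Sum>I<m. Z_single n N f h g e I * cnj (Z_single n N f h g e I))
    = complex_of_real
        (- (1 / 2) * ((g @\<^sub>v e) \<bullet> (M_matrix n (kinetic_matrix f h) *\<^sub>v (g @\<^sub>v e))))"
proof -
  note f = assms(4) and h = assms(5) and g = assms(8) and e = assms(9)
  define \<N> where "\<N> = kinetic_matrix f h"
  define R J K where "R = map_mat Re \<N>" and "J = map_mat Im \<N>" and "K = matinv J"
  note props = kinetic_matrix_properties[OF f h assms(6,7), folded \<N>_def, folded J_def, folded K_def]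
  have R: "R \<in> carrier_mat n n" and J: "J \<in> carrier_mat n n"
    using props(1) by (auto simp: R_def J_def)
  note inv = matinv_mult[OF J props(4), folded K_def]
  note K = inv(1)
  have Jt: "transpose_mat J = J"
    unfolding J_def map_mat_transpose props(2) ..
  \<comment> \<open>Since \<open>J\<close> is symmetric, \<open>transpose_mat K\<close> is a left
    inverse of \<open>J\<close> too, hence equal to \<open>K\<close>.\<close>
  have Kt: "transpose_mat K = K"
  proof -
    have "transpose_mat K * J = 1\<^sub>m n"
      using transpose_mult[OF J K] inv(2) Jt by simp
    then have "transpose_mat K * (J * K) = K"
      using K J by (simp add: assoc_mult_mat[of _ n n _ n _ n, symmetric] left_mult_one_mat[of _ n n])
    then show ?thesis using K inv(2) by (simp add: right_mult_one_mat[of _ n n])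
  qed
  let ?g = "map_vec complex_of_real g" and ?e = "map_vec complex_of_real e"
  let ?K = "map_mat complex_of_real K"
  \<comment> \<open>These are the real and imaginary parts of \<open>\<N> g - e\<close>, as
    \<open>g\<close> and \<open>e\<close> are real.\<close>
  define a b where "a = R *\<^sub>v g - e" and "b = J *\<^sub>v g"
  define w where "w = map_vec complex_of_real a + \<i> \<cdot>\<^sub>v map_vec complex_of_real b"
  have a: "a \<in> carrier_vec n" and b: "b \<in> carrier_vec n" and w: "w \<in> carrier_vec n"
    using R J g e by (auto simp: a_def b_def w_def)
  have w_eq: "w = \<N> *\<^sub>v ?g - ?e"
    using props(1) g e
    by (auto intro!: complex_eqI simp: w_def a_def b_def R_def J_def scalar_prod_def)
  define z where "z = transpose_mat h *\<^sub>v ?g - transpose_mat f *\<^sub>v ?e"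
  have "z = transpose_mat f *\<^sub>v w"
  proof -
    have "transpose_mat h = transpose_mat f * \<N>"
      using transpose_mult[OF props(1) f] props(2,3) by simp
    then show ?thesis
      unfolding z_def w_eq using f g e props(1)
      by (simp add: assoc_mult_mat_vec[of _ n n _ n] mult_minus_distrib_mat_vec[of _ n n])
  qed
  moreover from this have "conjugate z = mat_adjoint f *\<^sub>v conjugate w"
    using f w by (auto simp: mat_adjoint_eq_transpose_cnj scalar_prod_def)
  ultimately have "z \<bullet> conjugate z = w \<bullet> (f *\<^sub>v (mat_adjoint f *\<^sub>v conjugate w))"
    using transpose_vec_mult_scalar[OF f _ w] f w
    by (simp add: mat_adjoint_eq_transpose_cnj)
  \<comment> \<open>The factor of the final formula arises here, from inverting \<open>- 2\<close>
    in \<open>?K = - 2 f (mat_adjoint f)\<close>.\<close>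
  also have "f *\<^sub>v (mat_adjoint f *\<^sub>v conjugate w) = (- (1 / 2)) \<cdot>\<^sub>v (?K *\<^sub>v conjugate w)"
    unfolding props(5) using f w
    by (simp add: smult_mat_mult_vec[of _ n n] mat_adjoint_eq_transpose_cnj
        assoc_mult_mat_vec[of _ n n _ n] smult_smult_assoc)
  also have "w \<bullet> \<dots> = - (1 / 2) * (w \<bullet> (?K *\<^sub>v conjugate w))"
    using w K by (intro scalar_prod_smult_distrib[of _ n]) auto
  also have "w \<bullet> (?K *\<^sub>v conjugate w) = complex_of_real (a \<bullet> (K *\<^sub>v a) + b \<bullet> (K *\<^sub>v b))"
    unfolding w_def by (rule hermitian_form_of_real_symmetric[OF K Kt a b])
  \<comment> \<open>As \<open>K\<close> inverts \<open>J\<close>, the form of \<open>K\<close> at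
    \<open>b = J g\<close> becomes the form of \<open>J\<close> at \<open>g\<close>, the upper block
    of \<open>M_matrix\<close>.\<close>
  also have "K *\<^sub>v b = g"
    unfolding b_def using assoc_mult_mat_vec[OF K J g] inv(3) g by simp
  also have "b \<bullet> g = g \<bullet> (J *\<^sub>v g)"
    using transpose_vec_mult_scalar[OF J g g] Jt by (simp add: b_def)
  also have "a \<bullet> (K *\<^sub>v a) + g \<bullet> (J *\<^sub>v g) = (g @\<^sub>v e) \<bullet> (M_matrix n \<N> *\<^sub>v (g @\<^sub>v e))"
    using scalar_prod_M_matrix[OF props(1,2) _ g e, folded J_def R_def, folded K_def] K
    by (simp add: a_def)
  finally show ?thesis
    unfolding \<N>_def z_def sum_Z_eq_hermitian_square[OF assms(2,3) f h g e] by simp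
qed

end
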